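(* Let $m\ge1$. The formula $$S=\{(\ell(i-1),\,i,\,\overrightarrow{\ell}(i)+1) : 0<i\le m-1\}$$ establishes a bijection $\ell\mapsto S$ between the left bracketing functions $\ell\colon\mathbf m\to\mathbf m$ and the 2-cells $S\colon b_m\Longrightarrow e_m$ in the oriental $\mathcal O_m$.
   Context: $\mathbf m=\{0,1,\dots,m-1\}$ with its usual order. A left bracketing function (lbf) on $\mathbf m$ is a function $\ell\colon\mathbf m\to\mathbf m$ with (i) $\ell(j)\le j$ for all $j$; (ii) $\ell(j)\le i\le j$ implies $\ell(j)\le\ell(i)$; (iii) $\ell(m-1)=m-1$. The associated right bracketing function $\overrightarrow{\ell}\colon\mathbf m\to\mathbf m$ is given by $\overrightarrow\ell(0)=0$, $\overrightarrow\ell(m-1)=m-1$, and, for $0<i<m-1$, $\overrightarrow\ell(i)=\min\{j:\ell(j)<i\le j\}$ (with $\min\varnothing=m-1$). The oriental $\mathcal O_m$ is the free $m$-category on the $m$-simplex with vertices $0,1,\dots,m$; $b_m\colon0\to m$ is the 1-cell consisting of the single edge $(0\,m)$, and $e_m\colon 0\to m$ is the 1-cell consisting of the path of edges $(01),(12),\dots,(m-1\;m)$. The 2-cells $S\colon b_m\Rightarrow e_m$ have the following combinatorial description, which is taken as their definition here. A triangle is a triple $x=(x_0x_1x_2)$ of elements of $\{0,\dots,m\}$ with $x_0<x_1<x_2$; its left leg is $(x_0x_1)$, right leg $(x_1x_2)$, long leg $(x_0x_2)$. Put $x^-=\{(x_0x_2)\}$ and $x^+=\{(x_0x_1),(x_1x_2)\}$,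 and for a set $S$ of triangles put $S^-=\bigcup_{x\in S}x^-$, $S^+=\bigcup_{x\in S}x^+$. A 2-cell $S\colon b_m\Rightarrow e_m$ is (for $m\ge2$) a set $S$ of triangles such that (a) if two triangles in $S$ share the same left leg, or the same right leg, or the same long leg, then they are equal; (b) for $x,y\in S$, if $x_1=y_0$ then $x_2\ne y_1$; (c) $S^-\smallsetminus S^+=\{(0\,m)\}$; (d) $S^+\smallsetminus S^-=\{(01),(12),\dots,(m-1\;m)\}$. For $m=1$, $b_1=e_1$ and the only such 2-cell is the identity, which is the empty set of triangles. (These correspond to triangulations of the convex polygon with vertices $0,\dots,m$.) *)

theory Defs
  imports Complex_Main "HOL-Library.FuncSet"
begin

text \<open>
  The ordered set \<open>\<^bold>m\<close> is \<open>{..<m}\<close>. Functions \<open>\<^bold>m \<rightarrow> \<^bold>m\<close> are elements of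
  \<open>{..<m} \<rightarrow>\<^sub>E {..<m}\<close>: they are \<open>undefined\<close> outside \<open>{..<m}\<close>, so that equality of
  HOL functions is equality of functions on \<open>\<^bold>m\<close>.
\<close>

definition left_bracketing :: "nat \<Rightarrow> (nat \<Rightarrow> nat) \<Rightarrow> bool" where
  "left_bracketing m l \<longleftrightarrow>
     l \<in> {..<m} \<rightarrow>\<^sub>E {..<m} \<and>
     (\<forall>j<m. l j \<le> j) \<and>
     (\<forall>i<m. \<forall>j<m. l j \<le> i \<and> i \<le> j \<longrightarrow> l j \<le> l i) \<and>
     l (m - 1) = m - 1"

definition right_bracketing :: "nat \<Rightarrow> (nat \<Rightarrow> nat) \<Rightarrow> nat \<Rightarrow> nat" where
  "right_bracketing m l = (\<lambda>i\<in>{..<m}.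
     if i = 0 then 0
     else if i = m - 1 then m - 1
     else if \<exists>j<m. l j < i \<and> i \<le> j then Min {j. j < m \<and> l j < i \<and> i \<le> j}
     else m - 1)"

type_synonym edge = "nat \<times> nat"
type_synonym triangle = "nat \<times> nat \<times> nat"

definition triangles :: "nat \<Rightarrow> triangle set" where
  "triangles m = {(x0, x1, x2). x0 < x1 \<and> x1 < x2 \<and> x2 \<le> m}"

fun left_leg :: "triangle \<Rightarrow> edge" where
  "left_leg (x0, x1, x2) = (x0, x1)"

fun right_leg :: "triangle \<Rightarrow> edge" where
  "right_leg (x0, x1, x2) = (x1, x2)"

fun long_leg :: "triangle \<Rightarrow> edge" where
  "long_leg (x0, x1, x2) = (x0, x2)"

definition source_edges :: "triangle set \<Rightarrow> edge set" where
  "source_edges S = (\<Union>x\<in>S. {long_leg x})"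

definition target_edges :: "triangle set \<Rightarrow> edge set" where
  "target_edges S = (\<Union>x\<in>S. {left_leg x, right_leg x})"

text \<open>
  The 2-cells \<open>b\<^sub>m \<Rightarrow> e\<^sub>m\<close> of the oriental \<open>\<O>\<^sub>m\<close>, where \<open>b\<^sub>m\<close> is the single edge
  \<open>(0 m)\<close> and \<open>e\<^sub>m\<close> is the path \<open>(0 1), (1 2), \<dots>, (m-1 m)\<close>. For \<open>m = 1\<close> these 1-cells
  coincide and the only 2-cell between them is the identity, encoded as \<open>{}\<close>, which
  would not satisfy the last two conditions. Nothing is a 2-cell for \<open>m = 0\<close>, a case
  that is outside the intended range.
\<close>

definition two_cell :: "nat \<Rightarrow> triangle set \<Rightarrow> bool" where
  "two_cell m S \<longleftrightarrow>
     m = 1 \<and> S = {} \<or>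
     m \<ge> 2 \<and>
     S \<subseteq> triangles m \<and>
     (\<forall>x\<in>S. \<forall>y\<in>S.
        left_leg x = left_leg y \<or> right_leg x = right_leg y \<or> long_leg x = long_leg y
        \<longrightarrow> x = y) \<and>
     (\<forall>x0 x1 x2 y0 y1 y2.
        (x0, x1, x2) \<in> S \<and> (y0, y1, y2) \<in> S \<and> x1 = y0 \<longrightarrow> x2 \<noteq> y1) \<and>
     source_edges S - target_edges S = {(0, m)} \<and>
     target_edges S - source_edges S = {(i, i + 1) | i. i < m}"

end

theory Submission imports Defs begin

text \<open>
  Both sides have the recursive structure of binary trees. A triangulation of the polygon
  \<open>p, \<dots>, q\<close> is a root triangle \<open>(p, k, q)\<close> together with triangulations of \<open>p, \<dots>, k\<close>
  and \<open>k, \<dots>, q\<close>. On the other side, if \<open>k\<close> is the largest index whose triangle has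
  leftmost vertex \<open>p\<close>, then a bracketing function splits at \<open>k\<close> into bracketing functions
  of the two parts. A 2-cell contains the triangulation grown from its source edge
  \<open>(0, m)\<close>; there is no further triangle, since a longest one would have its long leg
  on a triangle of the triangulation already.
\<close>

section \<open>Polygon triangulations and their edges\<close>

inductive triangulation :: "nat \<Rightarrow> nat \<Rightarrow> triangle set \<Rightarrow> bool" where
  edge: "triangulation p (Suc p) {}"
| split: "triangulation p k S \<Longrightarrow> triangulation k q T \<Longrightarrow>
    triangulation p q (insert (p, k, q) (S \<union> T))"

text \<open>For \<open>p = 0\<close> and \<open>q = m\<close> this is the path \<open>e_m\<close>;
  general endpoints serve the subpolygons.\<close>

definition unit_edges :: "nat \<Rightarrow> nat \<Rightarrow> edge set" where
  "unit_edges p q = {(i, Suc i) | i. p \<le> i \<and> i < q}"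

lemma edges_simps [simp]:
  "source_edges {} = {}" "target_edges {} = {}"
  "source_edges (insert x S) = insert (long_leg x) (source_edges S)"
  "target_edges (insert x S) = insert (left_leg x) (insert (right_leg x) (target_edges S))"
  "source_edges (S \<union> T) = source_edges S \<union> source_edges T"
  "target_edges (S \<union> T) = target_edges S \<union> target_edges T"
  by (auto simp: source_edges_def target_edges_def)

lemma unit_edges_split:
  "p \<le> k \<Longrightarrow> k \<le> q \<Longrightarrow> unit_edges p q = unit_edges p k \<union> unit_edges k q"
  by (auto simp: unit_edges_def)

lemma triangulation_less: "triangulation p q S \<Longrightarrow> p < q"
  by (induction rule: triangulation.induct) auto

lemma triangulation_bounds:
  "triangulation p q S \<Longrightarrow> (x0, x1, x2) \<in> S \<Longrightarrow> p \<le> x0 \<and> x0 < x1 \<and> x1 < x2 \<and> x2 \<le> q"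
proof (induction arbitrary: x0 x1 x2 rule: triangulation.induct)
  case (split p k S q T)
  then consider "(x0, x1, x2) = (p, k, q)" | "(x0, x1, x2) \<in> S" | "(x0, x1, x2) \<in> T"
    by blast
  then show ?case
    using triangulation_less[OF split.hyps(1)] triangulation_less[OF split.hyps(2)]
      split.IH(1)[of x0 x1 x2] split.IH(2)[of x0 x1 x2]
    by cases auto
qed simp

text \<open>The added edge \<open>(p, q)\<close> and unit edges make the identity valid for a single edge too.\<close>

lemma triangulation_edges:
  "triangulation p q S \<Longrightarrow>
    source_edges S \<union> unit_edges p q = insert (p, q) (target_edges S)"
proof (induction rule: triangulation.induct)
  case (edge p)
  then show ?case by (auto simp: unit_edges_def)
next
  case (split p k S q T)
  have "unit_edges p q = unit_edges p k \<union> unit_edges k q"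
    using triangulation_less[OF split.hyps(1)] triangulation_less[OF split.hyps(2)]
    by (intro unit_edges_split) auto
  then have "source_edges (insert (p, k, q) (S \<union> T)) \<union> unit_edges p q =
      insert (p, q) ((source_edges S \<union> unit_edges p k) \<union> (source_edges T \<union> unit_edges k q))"
    by auto
  also have "\<dots> = insert (p, q) (target_edges (insert (p, k, q) (S \<union> T)))"
    unfolding split.IH by auto
  finally show ?case .
qed

text \<open>These are conditions (a) and (b) in coordinates. The two subpolygons share only the
  vertex \<open>k\<close>, and every triangle spans positive length, so triangles from different
  pieces can share no leg and cannot meet as (b) forbids. The root is told apart from the others by
  strict inequalities.\<close>

lemma triangulation_legs:
  "triangulation p q S \<Longrightarrow> (x0, x1, x2) \<in> S \<Longrightarrow> (y0, y1, y2) \<in> S \<Longrightarrow>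
    (x0 = y0 \<and> x1 = y1 \<longrightarrow> x2 = y2) \<and>
    (x1 = y1 \<and> x2 = y2 \<longrightarrow> x0 = y0) \<and>
    (x0 = y0 \<and> x2 = y2 \<longrightarrow> x1 = y1) \<and>
    (x1 = y0 \<longrightarrow> x2 \<noteq> y1)"
proof (induction arbitrary: x0 x1 x2 y0 y1 y2 rule: triangulation.induct)
  case (split p k S q T)
  note less = triangulation_less[OF split.hyps(1)] triangulation_less[OF split.hyps(2)]
  have within: "(z0, z1, z2) = (p, k, q) \<or>
      (z0, z1, z2) \<in> S \<and> p \<le> z0 \<and> z0 < z1 \<and> z1 < z2 \<and> z2 \<le> k \<or>
      (z0, z1, z2) \<in> T \<and> k \<le> z0 \<and> z0 < z1 \<and> z1 < z2 \<and> z2 \<le> q"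
    if "(z0, z1, z2) \<in> insert (p, k, q) (S \<union> T)" for z0 z1 z2
    using that triangulation_bounds[OF split.hyps(1), of z0 z1 z2]
      triangulation_bounds[OF split.hyps(2), of z0 z1 z2] by blast
  note x = within[OF split.prems(1)] and y = within[OF split.prems(2)]
  show ?case
  proof (cases "(x0, x1, x2) \<in> S \<and> (y0, y1, y2) \<in> S \<or> (x0, x1, x2) \<in> T \<and> (y0, y1, y2) \<in> T")
    case True
    then show ?thesis using split.IH by blast
  next
    case False
    with x y show ?thesis using less by (elim disjE conjE) auto
  qed
qed simp

section \<open>2-cells as triangulations of the whole polygon\<close>

lemma two_cell_if_triangulation:
  assumes "triangulation 0 m S"
  shows "two_cell m S"
proof (cases "m = 1")
  case True
  have "S = {}"
    using triangulation_bounds[OF assms] True by fastforce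
  then show ?thesis using True by (simp add: two_cell_def)
next
  case False
  then have m: "m \<ge> 2" using triangulation_less[OF assms] by simp
  have units: "unit_edges 0 m = {(i, i + 1) | i. i < m}"
    by (simp add: unit_edges_def)
  \<comment> \<open>Long legs span at least two units, and no short leg spans the whole polygon.
    Hence both unions in \<open>triangulation_edges\<close> are disjoint, and taking differences
    yields (c) and (d).\<close>
  have not_unit: "(0, m) \<notin> unit_edges 0 m"
    using m by (auto simp: unit_edges_def)
  have source: "source_edges S \<inter> unit_edges 0 m = {}"
    by (auto simp: source_edges_def unit_edges_def dest!: triangulation_bounds[OF assms])
  have target: "(0, m) \<notin> target_edges S"
    by (auto simp: target_edges_def dest!: triangulation_bounds[OF assms])
  have "S \<subseteq> triangles m"
    by (auto simp: triangles_def dest!: triangulation_bounds[OF assms])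
  moreover have "\<forall>x\<in>S. \<forall>y\<in>S.
      left_leg x = left_leg y \<or> right_leg x = right_leg y \<or> long_leg x = long_leg y \<longrightarrow> x = y"
  proof (intro ballI impI)
    fix x y assume xy: "x \<in> S" "y \<in> S"
      "left_leg x = left_leg y \<or> right_leg x = right_leg y \<or> long_leg x = long_leg y"
    obtain x0 x1 x2 where x: "x = (x0, x1, x2)" by (cases x)
    obtain y0 y1 y2 where y: "y = (y0, y1, y2)" by (cases y)
    show "x = y"
      using triangulation_legs[OF assms, of x0 x1 x2 y0 y1 y2] xy
      unfolding x y left_leg.simps right_leg.simps long_leg.simps prod.inject by blast
  qed
  moreover have "\<forall>x0 x1 x2 y0 y1 y2.
      (x0, x1, x2) \<in> S \<and> (y0, y1, y2) \<in> S \<and> x1 = y0 \<longrightarrow> x2 \<noteq> y1"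
    using triangulation_legs[OF assms] by blast
  moreover have "source_edges S - target_edges S = {(0, m)}"
    using triangulation_edges[OF assms] not_unit target source by blast
  moreover have "target_edges S - source_edges S = unit_edges 0 m"
    using triangulation_edges[OF assms] not_unit target source by blast
  ultimately show ?thesis
    using m units by (auto simp: two_cell_def)
qed

lemma triangulation_if_two_cell:
  assumes "two_cell m S"
  shows "triangulation 0 m S"
proof (cases "m = 1")
  case True
  then show ?thesis
    using assms triangulation.edge[of 0] by (simp add: two_cell_def)
next
  case False
  then have m: "m \<ge> 2"
    and S: "S \<subseteq> triangles m"
    and long: "\<And>x y. x \<in> S \<Longrightarrow> y \<in> S \<Longrightarrow> long_leg x = long_leg y \<Longrightarrow> x = y"
    and source: "source_edges S - target_edges S = {(0, m)}"
    and target: "target_edges S - source_edges S = unit_edges 0 m"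
    using assms by (auto simp: two_cell_def unit_edges_def)
  \<comment> \<open>Growth from an edge, by induction on its length: by (d) a short leg of a
    triangle of \<open>S\<close> is either a unit edge or again a long leg in
    \<open>S\<close>.\<close>
  have sub: "\<exists>T\<subseteq>S. triangulation p q T" if "(p, q) \<in> source_edges S \<union> unit_edges 0 m" for p q
    using that
  proof (induction "q - p" arbitrary: p q rule: less_induct)
    case less
    show ?case
    proof (cases "(p, q) \<in> unit_edges 0 m")
      case True
      then show ?thesis
        using triangulation.edge[of p] by (auto simp: unit_edges_def)
    next
      case False
      then obtain k where k: "(p, k, q) \<in> S"
        using less.prems by (auto simp: source_edges_def)
      then have pkq: "p < k" "k < q"
        using S by (auto simp: triangles_def)
      have "(p, k) \<in> target_edges S" "(k, q) \<in> target_edges S"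
        using k by (force simp: target_edges_def)+
      then have "(p, k) \<in> source_edges S \<union> unit_edges 0 m"
        "(k, q) \<in> source_edges S \<union> unit_edges 0 m"
        using target by blast+
      then obtain T U where TU: "T \<subseteq> S" "triangulation p k T" "U \<subseteq> S" "triangulation k q U"
        using less.hyps[of k p] less.hyps[of q k] pkq
        by (meson diff_less_mono diff_less_mono2 less_imp_le order.strict_trans)
      then have "triangulation p q (insert (p, k, q) (T \<union> U))"
        by (intro triangulation.split)
      then show ?thesis using TU k by (intro exI[of _ "insert (p, k, q) (T \<union> U)"]) auto
    qed
  qed
  obtain T where T: "T \<subseteq> S" "triangulation 0 m T"
    using sub[of 0 m] source by blast
  \<comment> \<open>Long legs are unique in \<open>S\<close>, so a long leg of \<open>T\<close>
    cannot belong to a second triangle of \<open>S\<close>.\<close>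
  have in_T: "x \<in> T" if "x \<in> S" "long_leg x \<in> source_edges T" for x
    using that(2) T(1) long[OF that(1)] unfolding source_edges_def by blast
  have not_unit: "long_leg x \<notin> unit_edges 0 m" if "x \<in> S" for x
    using that S by (auto simp: triangles_def unit_edges_def)
  have "(x0, x1, x2) \<in> T" if "(x0, x1, x2) \<in> S" for x0 x1 x2
    using that
  \<comment> \<open>Longest triangles come first: by (c), a long leg other than
    \<open>(0, m)\<close> is a short leg of some triangle of \<open>S\<close>, whose own long leg is
    strictly longer.\<close>
  proof (induction "m - (x2 - x0)" arbitrary: x0 x1 x2 rule: less_induct)
    case less
    have "(x0, x2) \<in> insert (0, m) (target_edges T)"
    proof (cases "(x0, x2) = (0, m)")
      case False
      have "(x0, x2) \<in> source_edges S"
        using less.prems by (force simp: source_edges_def)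
      then have "(x0, x2) \<in> target_edges S"
        using source False by blast
      then obtain y0 y1 y2 where y: "(y0, y1, y2) \<in> S" "(x0, x2) = (y0, y1) \<or> (x0, x2) = (y1, y2)"
        by (auto simp: target_edges_def)
      then have "m - (y2 - y0) < m - (x2 - x0)"
        using S less.prems by (fastforce simp: triangles_def)
      then have "(y0, y1, y2) \<in> T"
        using less.hyps y by blast
      then show ?thesis using y by (force simp: target_edges_def)
    qed simp
    then have "(x0, x2) \<in> source_edges T"
      using triangulation_edges[OF T(2)] not_unit[OF less.prems] by auto
    then show ?case using in_T less.prems by auto
  qed
  then have "S = T" using T(1) by auto
  then show ?thesis using T(2) by simp
qed

section \<open>Triangles determined by their left vertices\<close>

text \<open>
  The function \<open>a\<close> sends the middle vertex of a triangle to its left vertex, so that a left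
  bracketing function \<open>l\<close> corresponds to \<open>a i = l (i - 1)\<close>; the values at \<open>i \<le> p\<close> and
  \<open>i \<ge> q\<close> are irrelevant.
\<close>

definition left_vertices :: "nat \<Rightarrow> nat \<Rightarrow> (nat \<Rightarrow> nat) \<Rightarrow> bool" where
  "left_vertices p q a \<longleftrightarrow>
     (\<forall>i. p < i \<and> i < q \<longrightarrow> p \<le> a i \<and> a i < i) \<and>
     (\<forall>i j. p < i \<and> a j < i \<and> i \<le> j \<and> j < q \<longrightarrow> a j \<le> a i)"

text \<open>The alternative \<open>j = q\<close> caps the search, so the minimum exists; it plays
  the part of the convention for the minimum of the empty set.\<close>

definition right_vertex :: "nat \<Rightarrow> (nat \<Rightarrow> nat) \<Rightarrow> nat \<Rightarrow> nat" where
  "right_vertex q a i = (LEAST j. i < j \<and> (j = q \<or> a j < i))"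

definition vertex_triangles :: "nat \<Rightarrow> nat \<Rightarrow> (nat \<Rightarrow> nat) \<Rightarrow> triangle set" where
  "vertex_triangles p q a = {(a i, i, right_vertex q a i) | i. p < i \<and> i < q}"

lemma right_vertex_eqI:
  assumes "i < k" "k = q \<or> a k < i" "\<And>j. i < j \<Longrightarrow> j < k \<Longrightarrow> j \<noteq> q \<and> i \<le> a j"
  shows "right_vertex q a i = k"
  unfolding right_vertex_def
proof (rule Least_equality)
  fix j assume "i < j \<and> (j = q \<or> a j < i)"
  then show "k \<le> j" using assms(3)[of j] by (metis leD leI)
qed (use assms in auto)

lemma right_vertex:
  assumes "i < q"
  shows "i < right_vertex q a i" "right_vertex q a i = q \<or> a (right_vertex q a i) < i"
    "right_vertex q a i \<le> q"
    "i < j \<Longrightarrow> j < right_vertex q a i \<Longrightarrow> j \<noteq> q \<and> i \<le> a j"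
proof -
  have "i < right_vertex q a i \<and> (right_vertex q a i = q \<or> a (right_vertex q a i) < i)"
    unfolding right_vertex_def by (rule LeastI[of _ q]) (use assms in auto)
  then show "i < right_vertex q a i" "right_vertex q a i = q \<or> a (right_vertex q a i) < i"
    by auto
  show "right_vertex q a i \<le> q"
    unfolding right_vertex_def by (rule Least_le) (use assms in auto)
  show "i < j \<Longrightarrow> j < right_vertex q a i \<Longrightarrow> j \<noteq> q \<and> i \<le> a j"
    unfolding right_vertex_def by (drule not_less_Least) auto
qed

lemma right_vertex_cong:
  assumes "i < q" "\<And>j. i < j \<Longrightarrow> j < q \<Longrightarrow> a j = b j"
  shows "right_vertex q a i = right_vertex q b i"
  using assms right_vertex[where i = i and q = q and a = b]
  by (intro right_vertex_eqI) (auto simp: order_less_le)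

lemma vertex_triangles_cong:
  assumes "\<And>i. p < i \<Longrightarrow> i < q \<Longrightarrow> a i = b i"
  shows "vertex_triangles p q a = vertex_triangles p q b"
proof -
  have "right_vertex q a i = right_vertex q b i" if "p < i" "i < q" for i
    using assms that by (intro right_vertex_cong) auto
  then show ?thesis using assms unfolding vertex_triangles_def by force
qed

text \<open>A search starting left of \<open>k\<close> stops at \<open>k\<close> at the latest,
  because \<open>a k = p\<close>, so the cap \<open>k\<close> can replace \<open>q\<close>. The
  search from \<open>k\<close> itself runs up to \<open>q\<close>, because later left vertices are
  at least \<open>k\<close>.\<close>

lemma vertex_triangles_split:
  assumes "p < k" "k < q" "a k = p" "\<And>i. k < i \<Longrightarrow> i < q \<Longrightarrow> k \<le> a i"
  shows "vertex_triangles p q a =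
    insert (p, k, q) (vertex_triangles p k a \<union> vertex_triangles k q a)"
proof -
  have root: "right_vertex q a k = q"
    using assms by (intro right_vertex_eqI) auto
  have left: "right_vertex q a i = right_vertex k a i" if "p < i" "i < k" for i
    using assms that right_vertex[where i = i and q = k and a = a]
    by (intro right_vertex_eqI) auto
  have "{i. p < i \<and> i < q} = insert k ({i. p < i \<and> i < k} \<union> {i. k < i \<and> i < q})"
    using assms by auto
  then have "vertex_triangles p q a =
      (\<lambda>i. (a i, i, right_vertex q a i)) `
        insert k ({i. p < i \<and> i < k} \<union> {i. k < i \<and> i < q})"
    unfolding vertex_triangles_def by auto
  also have "\<dots> = insert (p, k, q) (vertex_triangles p k a \<union> vertex_triangles k q a)"
    unfolding vertex_triangles_def image_insert image_Un root assms(3)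
    using left by (auto simp: image_def)
  finally show ?thesis .
qed

lemma triangulation_vertex_triangles:
  "p < q \<Longrightarrow> left_vertices p q a \<Longrightarrow> triangulation p q (vertex_triangles p q a)"
proof (induction "q - p" arbitrary: p q rule: less_induct)
  case less
  show ?case
  proof (cases "q = Suc p")
    case True
    then have "vertex_triangles p q a = {}" by (auto simp: vertex_triangles_def)
    then show ?thesis using True triangulation.edge by simp
  next
    case False
    \<comment> \<open>The root is the last vertex attached to \<open>p\<close>. There is one because
      the bounds force \<open>a (Suc p) = p\<close>.\<close>
    define K where "K = {i. p < i \<and> i < q \<and> a i = p}"
    define k where "k = Max K"
    have bounds: "\<And>i. p < i \<Longrightarrow> i < q \<Longrightarrow> p \<le> a i \<and> a i < i"
      and mono: "\<And>i j. p < i \<Longrightarrow> a j < i \<Longrightarrow> i \<le> j \<Longrightarrow> j < q \<Longrightarrow> a j \<le> a i"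
      using less.prems by (auto simp: left_vertices_def)
    have "finite K" by (rule finite_subset[of _ "{..<q}"]) (auto simp: K_def)
    moreover have "Suc p \<in> K"
      using bounds[of "Suc p"] False less.prems by (auto simp: K_def)
    ultimately have "k \<in> K" and max: "\<And>i. i \<in> K \<Longrightarrow> i \<le> k"
      unfolding k_def using Max_in by auto
    then have k: "p < k" "k < q" "a k = p" by (auto simp: K_def)
    have right: "k \<le> a i" if "k < i" "i < q" for i
    proof (rule ccontr)
      assume "\<not> k \<le> a i"
      \<comment> \<open>A left vertex below \<open>k\<close> is at most \<open>a k = p\<close> by
        the nesting condition, so \<open>i\<close> would lie in \<open>K\<close> beyond its
        maximum.\<close>
      then have "a i \<le> p" using mono[of k i] k that by auto
      then have "i \<in> K" using bounds[of i] k that by (auto simp: K_def)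
      then show False using max that by fastforce
    qed
    have "left_vertices p k a" "left_vertices k q a"
      using bounds mono k right unfolding left_vertices_def by auto
    then have "triangulation p k (vertex_triangles p k a)"
      "triangulation k q (vertex_triangles k q a)"
      using less.hyps k by auto
    then show ?thesis
      using vertex_triangles_split[of p k q a, OF k right] triangulation.split by simp
  qed
qed

lemma triangulation_left_vertices:
  "triangulation p q S \<Longrightarrow> \<exists>a. left_vertices p q a \<and> S = vertex_triangles p q a"
proof (induction rule: triangulation.induct)
  case (edge p)
  then show ?case by (auto simp: left_vertices_def vertex_triangles_def)
next
  case (split p k S q T)
  then obtain a b where a: "left_vertices p k a" "S = vertex_triangles p k a"
    and b: "left_vertices k q b" "T = vertex_triangles k q b"
    by auto
  \<comment> \<open>The two functions are glued at \<open>k\<close>, where the root triangle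
    prescribes the left vertex \<open>p\<close>.\<close>
  define c where "c i = (if i < k then a i else if i = k then p else b i)" for i
  have pkq: "p < k" "k < q"
    using split.hyps triangulation_less by auto
  have "left_vertices p q c"
    unfolding left_vertices_def
  proof (intro conjI allI impI)
    fix i assume i: "p < i \<and> i < q"
    then consider "i < k" | "i = k" | "k < i" by linarith
    then show "p \<le> c i" "c i < i"
      by (cases; use i a b pkq in \<open>force simp: c_def left_vertices_def\<close>)+
  next
    fix i j assume ij: "p < i \<and> c j < i \<and> i \<le> j \<and> j < q"
    consider "j < k" | "j = k" | "k < j" by linarith
    then show "c j \<le> c i"
    proof cases
      case 1
      then show ?thesis using ij a by (auto simp: c_def left_vertices_def)
    next
      case 2
      then show ?thesis using ij a by (auto simp: c_def left_vertices_def)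
    next
      case 3
      \<comment> \<open>Now \<open>k < i\<close> as well, so only \<open>b\<close> is
        involved.\<close>
      then have "k \<le> b j" using ij b by (auto simp: left_vertices_def)
      then show ?thesis using 3 ij b by (auto simp: c_def left_vertices_def)
    qed
  qed
  moreover have "vertex_triangles p q c =
      insert (p, k, q) (vertex_triangles p k c \<union> vertex_triangles k q c)"
    using pkq b by (intro vertex_triangles_split) (auto simp: c_def left_vertices_def)
  moreover have "vertex_triangles p k c = S" "vertex_triangles k q c = T"
    unfolding a b by (intro vertex_triangles_cong; simp add: c_def)+
  ultimately show ?case by auto
qed

section \<open>Passage between bracketing functions and left vertices\<close>

lemma left_vertices_if_left_bracketing:
  assumes "left_bracketing m l"
  shows "left_vertices 0 m (\<lambda>i. l (i - 1))"
  unfolding left_vertices_def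
proof (intro conjI allI impI)
  fix i assume "0 < i \<and> i < m"
  then show "l (i - 1) < i"
    using assms by (cases i) (auto simp: left_bracketing_def less_Suc_eq_le)
next
  fix i j assume "0 < i \<and> l (j - 1) < i \<and> i \<le> j \<and> j < m"
  then show "l (j - 1) \<le> l (i - 1)"
    using assms by (cases i; cases j) (auto simp: left_bracketing_def)
qed simp

text \<open>A candidate \<open>j\<close> for the minimum corresponds to \<open>j + 1\<close> in the
  search, and the default \<open>m - 1\<close> to the cap \<open>m\<close>.\<close>

lemma right_bracketing_Suc:
  assumes "left_bracketing m l" "0 < i" "i < m"
  shows "right_bracketing m l i + 1 = right_vertex m (\<lambda>i. l (i - 1)) i"
proof -
  let ?J = "{j. j < m \<and> l j < i \<and> i \<le> j}"
  have last: "l (m - 1) = m - 1" using assms by (simp add: left_bracketing_def)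
  show ?thesis
  proof (cases "?J = {}")
    case True
    then have "right_bracketing m l i = m - 1"
      using assms by (auto simp: right_bracketing_def)
    moreover have "right_vertex m (\<lambda>i. l (i - 1)) i = m"
    proof (rule right_vertex_eqI)
      fix j assume "i < j" "j < m"
      then have "j - 1 \<notin> ?J" "j - 1 < m" "i \<le> j - 1" "j \<noteq> m" unfolding True by auto
      then show "j \<noteq> m \<and> i \<le> l (j - 1)" by simp
    qed (use assms in auto)
    ultimately show ?thesis using assms by simp
  next
    case False
    define n where "n = Min ?J"
    have n: "n < m" "l n < i" "i \<le> n" and least: "\<And>j. j \<in> ?J \<Longrightarrow> n \<le> j"
      using Min_in[of ?J] Min_le[of ?J] False unfolding n_def by auto
    \<comment> \<open>This excludes the special clause for \<open>m - 1\<close>: the only candidate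
      there would be \<open>m - 1\<close> itself, which \<open>l (m - 1) = m - 1\<close> rules
      out.\<close>
    have "i \<noteq> m - 1"
    proof
      assume "i = m - 1"
      then have "n = m - 1" using n by linarith
      then show False using n last \<open>i = m - 1\<close> by auto
    qed
    then have "right_bracketing m l i = n"
      using assms False unfolding n_def by (auto simp: right_bracketing_def)
    moreover have "right_vertex m (\<lambda>i. l (i - 1)) i = n + 1"
    proof (rule right_vertex_eqI)
      fix j assume j: "i < j" "j < n + 1"
      then have "j - 1 \<notin> ?J" using least[of "j - 1"] by linarith
      then show "j \<noteq> m \<and> i \<le> l (j - 1)" using j n last assms by auto
    qed (use n in auto)
    ultimately show ?thesis by simp
  qed
qed

text \<open>This inverts the shift. The value at \<open>m - 1\<close> would come from the
  unconstrained \<open>a m\<close>, so it is set as (iii) demands.\<close>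

lemma left_bracketing_of_left_vertices:
  assumes "0 < m" "left_vertices 0 m a"
  shows "left_bracketing m (\<lambda>j\<in>{..<m}. if j = m - 1 then m - 1 else a (Suc j))"
proof -
  have bounds: "a (Suc j) \<le> j" if "Suc j < m" for j
    using assms(2) that unfolding left_vertices_def by (metis less_Suc_eq_le zero_less_Suc)
  have mono: "a (Suc j) \<le> a (Suc i)" if "a (Suc j) \<le> i" "i \<le> j" "Suc j < m" for i j
    using assms(2) that unfolding left_vertices_def
    by (metis Suc_le_mono less_Suc_eq_le zero_less_Suc)
  have "a (Suc j) < m" if "Suc j < m" for j
    using bounds[OF that] that by linarith
  moreover have "Suc j < m" if "j < m" "j \<noteq> m - 1" for j
    using that by linarith
  ultimately show ?thesis
    unfolding left_bracketing_def using assms(1) bounds mono by auto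
qed

theorem proposition6p1:
  fixes m :: nat
  assumes "m \<ge> 1"
  shows "bij_betw
    (\<lambda>l. {(l (i - 1), i, right_bracketing m l i + 1) | i. 0 < i \<and> i \<le> m - 1})
    {l. left_bracketing m l}
    {S. two_cell m S}"
proof -
  let ?F = "\<lambda>l. {(l (i - 1), i, right_bracketing m l i + 1) | i. 0 < i \<and> i \<le> m - 1}"
  have F: "?F l = vertex_triangles 0 m (\<lambda>i. l (i - 1))" if "left_bracketing m l" for l
  proof -
    have "?F l = {(l (i - 1), i, right_bracketing m l i + 1) | i. 0 < i \<and> i < m}"
      using assms by (auto simp: Suc_le_eq)
    also have "\<dots> = vertex_triangles 0 m (\<lambda>i. l (i - 1))"
      using right_bracketing_Suc[OF that] unfolding vertex_triangles_def by force
    finally show ?thesis .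
  qed
  show ?thesis
    unfolding bij_betw_def
  proof (intro conjI)
    show "inj_on ?F {l. left_bracketing m l}"
    proof (rule inj_onI)
      fix l l' assume l: "l \<in> {l. left_bracketing m l}" and l': "l' \<in> {l. left_bracketing m l}"
        and eq: "?F l = ?F l'"
      \<comment> \<open>Each inner vertex is the middle of exactly one triangle, whose left vertex
        recovers \<open>l\<close>; the last value is fixed by (iii).\<close>
      have eq_at: "l j = l' j" if "j < m" for j
      proof (cases "j = m - 1")
        case True
        then show ?thesis using l l' by (simp add: left_bracketing_def)
      next
        case False
        then have "(l j, Suc j, right_bracketing m l (Suc j) + 1) \<in> ?F l"
          using that by force
        then have "(l j, Suc j, right_bracketing m l (Suc j) + 1) \<in> ?F l'"
          by (simp only: eq)
        then show ?thesis by auto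
      qed
      show "l = l'"
        using l l'
        by (intro PiE_ext[of l "{..<m}" "\<lambda>_. {..<m}"])
          (auto simp: left_bracketing_def eq_at)
    qed
    show "?F ` {l. left_bracketing m l} = {S. two_cell m S}"
    proof (intro set_eqI iffI)
      fix S assume "S \<in> ?F ` {l. left_bracketing m l}"
      then obtain l where l: "left_bracketing m l" "S = ?F l" by auto
      have "triangulation 0 m S"
        unfolding l(2) F[OF l(1)] using assms left_vertices_if_left_bracketing[OF l(1)]
        by (intro triangulation_vertex_triangles) auto
      then show "S \<in> {S. two_cell m S}" using two_cell_if_triangulation by simp
    next
      fix S assume "S \<in> {S. two_cell m S}"
      then obtain a where a: "left_vertices 0 m a" "S = vertex_triangles 0 m a"
        using triangulation_if_two_cell triangulation_left_vertices by blast
      define l where "l = (\<lambda>j\<in>{..<m}. if j = m - 1 then m - 1 else a (Suc j))"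
      have l: "left_bracketing m l"
        unfolding l_def using assms a by (intro left_bracketing_of_left_vertices) auto
      have "?F l = S"
        unfolding F[OF l] a by (rule vertex_triangles_cong) (auto simp: l_def)
      then show "S \<in> ?F ` {l. left_bracketing m l}" using l by blast
    qed
  qed
qed

end
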